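(* Let $G$ be a connected graph with at least three vertices that has no non-trivial bridge and in which no two bad leaves are at distance exactly 4 in $G$. Then $G^2$ has a $[2,4]$-factor.
   Context: All graphs are finite, simple and undirected. The square $G^2$ of $G$ is the graph on $V(G)$ in which two distinct vertices are adjacent iff their distance in $G$ is at most 2. A factor is a spanning subgraph; a $[2,4]$-factor is a connected factor in which every vertex has degree 2 or 4. A leaf is a vertex of degree 1. A cut vertex $y$ of a connected graph $G$ is trivial if $y$ is not a cut vertex of $G-M$, where $M$ is the set of all leaves adjacent to $y$; otherwise it is non-trivial. A leaf $x$ is a bad leaf if its neighbor $y$ is a trivial cut vertex of $G$ and $x$ is the only leaf adjacent to $y$. A trivial bridge is a cut-edge (bridge) of $G$ one of whose endpoints is a leaf; a bridge that is not trivial is non-trivial. *)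

theory Defs
  imports Main
begin

text \<open>A finite simple graph is a pair of a vertex set V and a set E of
  2-element subsets of V.\<close>

definition simple_graph :: "'a set \<Rightarrow> 'a set set \<Rightarrow> bool" where
  "simple_graph V E \<longleftrightarrow> finite V \<and>
     (\<forall>e\<in>E. \<exists>u v. e = {u, v} \<and> u \<noteq> v \<and> u \<in> V \<and> v \<in> V)"

definition adj :: "'a set set \<Rightarrow> 'a \<Rightarrow> 'a \<Rightarrow> bool" where
  "adj E u v \<longleftrightarrow> {u, v} \<in> E"

definition connected_graph :: "'a set \<Rightarrow> 'a set set \<Rightarrow> bool" where
  "connected_graph V E \<longleftrightarrow>
     (\<forall>u\<in>V. \<forall>v\<in>V. (u, v) \<in> {(x, y). adj E x y}\<^sup>*)"

definition degree :: "'a set set \<Rightarrow> 'a \<Rightarrow> nat" where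
  "degree E v = card {e \<in> E. v \<in> e}"

text \<open>A walk is a nonempty list of vertices with consecutive vertices adjacent.\<close>
definition walk :: "'a set set \<Rightarrow> 'a list \<Rightarrow> bool" where
  "walk E xs \<longleftrightarrow> xs \<noteq> [] \<and> (\<forall>i. Suc i < length xs \<longrightarrow> adj E (xs ! i) (xs ! Suc i))"

text \<open>Distance: length of a shortest walk (meaningful for vertices in the same component).\<close>
definition gdist :: "'a set set \<Rightarrow> 'a \<Rightarrow> 'a \<Rightarrow> nat" where
  "gdist E u v = (LEAST n. \<exists>xs. walk E xs \<and> hd xs = u \<and> last xs = v \<and> length xs = Suc n)"

text \<open>Vertex deletion G - S.\<close>
definition del_edges :: "'a set set \<Rightarrow> 'a set \<Rightarrow> 'a set set" where
  "del_edges E S = {e \<in> E. e \<inter> S = {}}"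

definition is_leaf :: "'a set \<Rightarrow> 'a set set \<Rightarrow> 'a \<Rightarrow> bool" where
  "is_leaf V E x \<longleftrightarrow> x \<in> V \<and> degree E x = 1"

text \<open>Cut vertex of a connected graph: its removal disconnects the graph.\<close>
definition cut_vertex :: "'a set \<Rightarrow> 'a set set \<Rightarrow> 'a \<Rightarrow> bool" where
  "cut_vertex V E y \<longleftrightarrow> y \<in> V \<and> \<not> connected_graph (V - {y}) (del_edges E {y})"

definition leaves_at :: "'a set \<Rightarrow> 'a set set \<Rightarrow> 'a \<Rightarrow> 'a set" where
  "leaves_at V E y = {x. is_leaf V E x \<and> adj E x y}"

definition trivial_cut_vertex :: "'a set \<Rightarrow> 'a set set \<Rightarrow> 'a \<Rightarrow> bool" where
  "trivial_cut_vertex V E y \<longleftrightarrow> cut_vertex V E y \<and>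
     \<not> cut_vertex (V - leaves_at V E y) (del_edges E (leaves_at V E y)) y"

definition bad_leaf :: "'a set \<Rightarrow> 'a set set \<Rightarrow> 'a \<Rightarrow> bool" where
  "bad_leaf V E x \<longleftrightarrow> is_leaf V E x \<and>
     (\<exists>y. adj E x y \<and> trivial_cut_vertex V E y \<and> leaves_at V E y = {x})"

definition bridge :: "'a set \<Rightarrow> 'a set set \<Rightarrow> 'a set \<Rightarrow> bool" where
  "bridge V E e \<longleftrightarrow> e \<in> E \<and> \<not> connected_graph V (E - {e})"

definition trivial_bridge :: "'a set \<Rightarrow> 'a set set \<Rightarrow> 'a set \<Rightarrow> bool" where
  "trivial_bridge V E e \<longleftrightarrow> bridge V E e \<and> (\<exists>x\<in>e. is_leaf V E x)"

definition nontrivial_bridge :: "'a set \<Rightarrow> 'a set set \<Rightarrow> 'a set \<Rightarrow> bool" where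
  "nontrivial_bridge V E e \<longleftrightarrow> bridge V E e \<and> \<not> trivial_bridge V E e"

text \<open>The square G^2 (edge set on the same vertex set V).\<close>
definition square :: "'a set \<Rightarrow> 'a set set \<Rightarrow> 'a set set" where
  "square V E = {{u, v} | u v. u \<in> V \<and> v \<in> V \<and> u \<noteq> v \<and> gdist E u v \<le> 2}"

text \<open>A [2,4]-factor of the graph (V, H): a connected spanning subgraph (V, F)
  in which every vertex has degree 2 or 4.\<close>
definition factor_24 :: "'a set \<Rightarrow> 'a set set \<Rightarrow> 'a set set \<Rightarrow> bool" where
  "factor_24 V H F \<longleftrightarrow> F \<subseteq> H \<and> connected_graph V F \<and>
     (\<forall>v\<in>V. degree F v = 2 \<or> degree F v = 4)"

end

theory Submission
  imports Defs
begin

text \<open>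
  Call a factor of \<open>G\<^sup>2\<close> on a vertex set \<open>S\<close> rooted at \<open>r\<close> if \<open>r\<close> has degree 2 in it and some
  factor edge at \<open>r\<close> is an edge of \<open>G\<close>. The factor is built by depth-first induction: given a
  connected \<open>S\<close> and \<open>r \<in> S\<close>, every component \<open>K\<close> of \<open>S - r\<close> contains a neighbour \<open>k\<close> of \<open>r\<close>, and
  a factor of \<open>K\<close> rooted at \<open>k\<close> is glued in by rerouting a factor edge \<open>rk'\<close>, with \<open>k'\<close> a neighbour
  of \<open>r\<close>, through \<open>k\<close>; this raises the degree of \<open>k\<close> from 2 to 4. If \<open>K\<close> is the only component, \<open>r\<close>
  is inserted into a factor edge \<open>kd\<close> instead.

  Only components \<open>K = {v, c}\<close> with \<open>c\<close> not adjacent to \<open>r\<close> cause trouble. If \<open>c\<close> has a neighbour outside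
  \<open>S\<close>, which is then an earlier root, \<open>c\<close> is left over and inserted there. Otherwise \<open>c\<close> is a leaf and
  in fact a bad leaf, because removing \<open>{v, c}\<close> leaves the graph connected. Two such components at the
  same root would give bad leaves at distance 4, so at most one occurs, and it can be treated first,
  by the triangle \<open>r, v, c\<close>.
\<close>

section \<open>Reachability and connectedness of edge sets\<close>

abbreviation reach :: "'a set set \<Rightarrow> 'a \<Rightarrow> 'a \<Rightarrow> bool" where
  "reach F x y \<equiv> (x, y) \<in> {(x, y). adj F x y}\<^sup>*"

lemma adj_commute: "adj F x y \<longleftrightarrow> adj F y x"
  by (simp add: adj_def insert_commute)

lemma reach_sym: "reach F x y \<Longrightarrow> reach F y x"
  using sym_rtrancl[of "{(x, y). adj F x y}"] by (auto simp: sym_def adj_commute)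

lemma reach_edge: "{x, y} \<in> F \<Longrightarrow> reach F x y"
  by (simp add: adj_def r_into_rtrancl)

lemma reach_replace:
  assumes "reach F x y" and "\<And>u v. {u, v} \<in> F \<Longrightarrow> reach F' u v"
  shows "reach F' x y"
  using assms(1)
proof (induction rule: rtrancl_induct)
  case (step y z)
  then show ?case using assms(2)[of y z] by (auto simp: adj_def)
qed simp

lemma reach_mono: "reach F x y \<Longrightarrow> F \<subseteq> F' \<Longrightarrow> reach F' x y"
  by (rule reach_replace) (auto intro: reach_edge)

lemma connected_graphI:
  assumes "\<And>x. x \<in> S \<Longrightarrow> reach F r x"
  shows "connected_graph S F"
  unfolding connected_graph_def using assms by (meson reach_sym rtrancl_trans)

lemma connected_graph_Un:
  assumes "connected_graph S F" "connected_graph T F"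
    and "a \<in> S" "b \<in> T" "reach F a b"
  shows "connected_graph (S \<union> T) F"
proof (rule connected_graphI)
  fix x assume "x \<in> S \<union> T"
  then show "reach F a x"
  proof
    assume "x \<in> S"
    then show ?thesis using assms(1,3) by (simp add: connected_graph_def)
  next
    assume "x \<in> T"
    then have "reach F b x" using assms(2,4) by (simp add: connected_graph_def)
    then show ?thesis by (rule rtrancl_trans[OF assms(5)])
  qed
qed

lemma connected_graph_mono:
  "connected_graph S F \<Longrightarrow> F \<subseteq> F' \<Longrightarrow> connected_graph S F'"
  unfolding connected_graph_def by (blast intro: reach_mono)

section \<open>Degrees and the subdivision of an edge\<close>

lemma degree_insert:
  "finite F \<Longrightarrow> e \<notin> F \<Longrightarrow> degree (insert e F) v = degree F v + (if v \<in> e then 1 else 0)"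
proof -
  assume "finite F" "e \<notin> F"
  moreover have "{d \<in> insert e F. v \<in> d} =
      (if v \<in> e then insert e {d \<in> F. v \<in> d} else {d \<in> F. v \<in> d})" by auto
  ultimately show ?thesis by (simp add: degree_def)
qed

lemma degree_eq_0: "F \<subseteq> Pow S \<Longrightarrow> v \<notin> S \<Longrightarrow> degree F v = 0"
proof -
  assume "F \<subseteq> Pow S" "v \<notin> S"
  then have "{e \<in> F. v \<in> e} = {}" by auto
  then show ?thesis unfolding degree_def by (metis card.empty)
qed

lemma degree_empty [simp]: "degree {} v = 0"
  by (simp add: degree_def)

text \<open>Replacing \<open>pq\<close> by the path \<open>p\<close>, \<open>a\<close>,
  \<open>q\<close> trades one edge for another at \<open>p\<close> and at \<open>q\<close>, so only
  the joining vertex \<open>a\<close> gains degree.\<close>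

lemma subdivide_degree:
  assumes fin: "finite S" "finite T" and disj: "S \<inter> T = {}"
    and F: "F \<subseteq> Pow S" "{p, q} \<in> F" "p \<noteq> q" and H: "H \<subseteq> Pow T" "a \<in> T"
  shows "degree (insert {p, a} (insert {a, q} (F - {{p, q}} \<union> H))) v
    = degree F v + degree H v + (if v = a then 2 else 0)"
proof -
  have pq: "p \<in> S" "q \<in> S" using F by auto
  have finF: "finite F" "finite H"
    using fin F(1) H(1) by (meson finite_Pow_iff finite_subset)+
  have a: "a \<notin> S" "a \<noteq> p" "a \<noteq> q" using disj H(2) pq by auto
  have new: "{p, a} \<notin> F" "{a, q} \<notin> F" "{p, a} \<notin> H" "{a, q} \<notin> H" "{p, a} \<noteq> {a, q}"
    using a pq F(1,3) H(1) disj by (auto simp: doubleton_eq_iff)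
  \<comment> \<open>Subsets of \<open>Pow S\<close> and \<open>Pow T\<close> may share the empty
    set; as it contains no \<open>v\<close>, it does not affect degrees.\<close>
  have FH: "(F - {{p, q}}) \<inter> H \<subseteq> {{}}" using F(1) H(1) disj by blast
  have "{e \<in> F - {{p, q}} \<union> H. v \<in> e} = {e \<in> F - {{p, q}}. v \<in> e} \<union> {e \<in> H. v \<in> e}" by auto
  moreover have "{e \<in> F - {{p, q}}. v \<in> e} \<inter> {e \<in> H. v \<in> e} = {}" using FH by auto
  ultimately have "degree (F - {{p, q}} \<union> H) v = degree (F - {{p, q}}) v + degree H v"
    unfolding degree_def using finF by (simp add: card_Un_disjoint)
  moreover have "degree F v = degree (F - {{p, q}}) v + (if v \<in> {p, q} then 1 else 0)"
    using degree_insert[of "F - {{p, q}}" "{p, q}" v] finF F(2) by (simp add: insert_absorb)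
  ultimately show ?thesis
    using finF new a F(3) by (simp add: degree_insert)
qed

text \<open>A walk that used \<open>pq\<close> can detour through \<open>a\<close>, so
  \<open>S\<close> stays connected, and the edge \<open>pa\<close> links it to
  \<open>T\<close>.\<close>

lemma subdivide_connected:
  assumes "connected_graph S F" "connected_graph T H" "{p, q} \<in> F" "p \<in> S" "a \<in> T"
  shows "connected_graph (S \<union> T) (insert {p, a} (insert {a, q} (F - {{p, q}} \<union> H)))"
    (is "connected_graph _ ?F'")
proof -
  have pa: "reach ?F' p a" and aq: "reach ?F' a q" by (auto intro: reach_edge)
  have pq: "reach ?F' p q" using pa aq by (rule rtrancl_trans)
  have rep: "reach ?F' u v" if "{u, v} \<in> F" for u v
  proof (cases "{u, v} = {p, q}")
    case True
    then show ?thesis using pq reach_sym[OF pq] by (auto simp: doubleton_eq_iff)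
  next
    case False
    then show ?thesis using that by (auto intro: reach_edge)
  qed
  have "connected_graph S ?F'"
    using assms(1) reach_replace[OF _ rep] unfolding connected_graph_def by blast
  moreover have "connected_graph T ?F'"
    using assms(2) by (rule connected_graph_mono) auto
  ultimately show ?thesis
    using assms(4,5) pa by (rule connected_graph_Un)
qed

section \<open>Factors in the square and how they are glued\<close>

locale sgraph =
  fixes V :: "'a set" and E :: "'a set set"
  assumes simple: "simple_graph V E"
begin

lemma finite_V: "finite V"
  using simple by (simp add: simple_graph_def)

lemma adjD: "adj E u v \<Longrightarrow> u \<in> V \<and> v \<in> V \<and> u \<noteq> v"
  using simple unfolding simple_graph_def adj_def by (metis doubleton_eq_iff)

lemma gdist_le: "walk E xs \<Longrightarrow> length xs = Suc n \<Longrightarrow> gdist E (hd xs) (last xs) \<le> n"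
  unfolding gdist_def by (rule Least_le) auto

lemma square_adj: "adj E u v \<Longrightarrow> {u, v} \<in> square V E"
proof -
  assume uv: "adj E u v"
  then have "gdist E u v \<le> 1" using gdist_le[of "[u, v]" 1] by (simp add: walk_def)
  then have "gdist E u v \<le> 2" by simp
  then show ?thesis using adjD[OF uv] unfolding square_def by blast
qed

lemma square_2:
  assumes "adj E w u" "adj E w v" "u \<noteq> v"
  shows "{u, v} \<in> square V E"
proof -
  have "walk E [u, w, v]"
    using assms by (auto simp: walk_def nth_Cons adj_commute split: nat.splits)
  then have "gdist E u v \<le> 2" using gdist_le[of "[u, w, v]" 2] by simp
  then show ?thesis using assms adjD by (auto simp: square_def)
qed

text \<open>The graph edge \<open>rk\<close> keeps rerouting inside the square: every neighbour of
  \<open>r\<close> is within distance 2 of \<open>k\<close>.\<close>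

definition rooted_factor :: "'a set \<Rightarrow> 'a \<Rightarrow> bool" where
  "rooted_factor S r \<longleftrightarrow> (\<exists>F. F \<subseteq> square V E \<inter> Pow S \<and> connected_graph S F \<and> r \<in> S \<and>
     (\<forall>v\<in>S. degree F v = 2 \<or> degree F v = 4) \<and> degree F r = 2 \<and>
     (\<exists>k. {r, k} \<in> F \<and> adj E r k))"

text \<open>Degree 0 at the root admits a single vertex; attaching adds 2 there, so the final degree
  is 2 or 4.\<close>

definition piece :: "'a set \<Rightarrow> 'a \<Rightarrow> bool" where
  "piece S r \<longleftrightarrow> (\<exists>F. F \<subseteq> square V E \<inter> Pow S \<and> connected_graph S F \<and> r \<in> S \<and>
     (\<forall>v\<in>S - {r}. degree F v = 2 \<or> degree F v = 4) \<and> (degree F r = 0 \<or> degree F r = 2))"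

lemma piece_single: "piece {a} a"
  unfolding piece_def by (rule exI[of _ "{}"]) (simp add: connected_graph_def)

lemma rooted_factor_piece: "rooted_factor S r \<Longrightarrow> piece S r"
  unfolding rooted_factor_def piece_def by blast

text \<open>The edge \<open>rk\<close> is rerouted through \<open>a\<close>. The root keeps degree
  2, and \<open>ra\<close> replaces \<open>rk\<close> as its graph edge, so the step can be repeated
  with further pieces.\<close>

lemma rooted_factor_attach:
  assumes S: "rooted_factor S r" and T: "piece T a"
    and "adj E r a" "S \<inter> T = {}" "S \<subseteq> V" "T \<subseteq> V"
  shows "rooted_factor (S \<union> T) r"
proof -
  from S obtain F k where F: "F \<subseteq> square V E \<inter> Pow S" "connected_graph S F" "r \<in> S"
    "\<forall>v\<in>S. degree F v = 2 \<or> degree F v = 4" "degree F r = 2" "{r, k} \<in> F" "adj E r k"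
    unfolding rooted_factor_def by blast
  from T obtain H where H: "H \<subseteq> square V E \<inter> Pow T" "connected_graph T H" "a \<in> T"
    "\<forall>v\<in>T - {a}. degree H v = 2 \<or> degree H v = 4" "degree H a = 0 \<or> degree H a = 2"
    unfolding piece_def by blast
  have FS: "F \<subseteq> Pow S" and HT: "H \<subseteq> Pow T" using F(1) H(1) by auto
  let ?F = "insert {r, a} (insert {a, k} (F - {{r, k}} \<union> H))"
  have k: "k \<in> S" "r \<noteq> k" using F adjD by auto
  have fin: "finite S" "finite T" using assms finite_V finite_subset by blast+
  have deg: "degree ?F v = degree F v + degree H v + (if v = a then 2 else 0)" for v
    by (rule subdivide_degree) (use fin F H k assms in auto)
  have con: "connected_graph (S \<union> T) ?F"
    by (rule subdivide_connected) (use F H in auto)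
  have "{a, k} \<in> square V E" using square_2 assms(3) F(7) k H(3) assms(4) by blast
  then have sub: "?F \<subseteq> square V E \<inter> Pow (S \<union> T)"
    using F H k square_adj[OF assms(3)] by auto
  have "degree ?F v = 2 \<or> degree ?F v = 4" if "v \<in> S \<union> T" for v
  proof (cases "v \<in> S")
    case True
    then have "v \<notin> T" using assms by blast
    then show ?thesis using True F(4) degree_eq_0[OF HT] H(3) deg[of v] by auto
  next
    case False
    then have "v \<in> T" using that by blast
    then show ?thesis using False H(4,5) degree_eq_0[OF FS] deg[of v] by auto
  qed
  moreover have "degree ?F r = 2"
    using deg[of r] F(3,5) H(3) assms(4) degree_eq_0[OF HT, of r] by auto
  ultimately show ?thesis
    unfolding rooted_factor_def using sub con F(3) assms(3) by blast
qed

text \<open>The graph edge \<open>kd\<close> is subdivided by \<open>r\<close>; the new edge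
  \<open>rd\<close> lies in the square because \<open>k\<close> is a common neighbour.\<close>

lemma rooted_factor_new_root:
  assumes S: "rooted_factor S k" and "adj E r k" "r \<notin> S" "S \<subseteq> V"
  shows "rooted_factor (insert r S) r"
proof -
  from S obtain F d where F: "F \<subseteq> square V E \<inter> Pow S" "connected_graph S F" "k \<in> S"
    "\<forall>v\<in>S. degree F v = 2 \<or> degree F v = 4" "{k, d} \<in> F" "adj E k d"
    unfolding rooted_factor_def by blast
  have FS: "F \<subseteq> Pow S" using F(1) by auto
  \<comment> \<open>The empty union stands for the edgeless graph on \<open>{r}\<close> and gives
    the set the shape of the subdivision lemmas.\<close>
  let ?F = "insert {k, r} (insert {r, d} (F - {{k, d}} \<union> {}))"
  have d: "d \<in> S" "k \<noteq> d" using F adjD by auto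
  have fin: "finite S" using assms finite_V finite_subset by blast
  have deg: "degree ?F v = degree F v + degree {} v + (if v = r then 2 else 0)" for v
    by (rule subdivide_degree[of S "{r}"]) (use fin F d assms in auto)
  have "connected_graph (S \<union> {r}) ?F"
    by (rule subdivide_connected) (use F in \<open>auto simp: connected_graph_def\<close>)
  then have con: "connected_graph (insert r S) ?F" by simp
  have "{r, d} \<in> square V E"
    using square_2[of k r d] assms(2,3) F(6) d by (auto simp: adj_commute)
  then have sub: "?F \<subseteq> square V E \<inter> Pow (insert r S)"
    using F d square_adj[OF assms(2)] by (auto simp: insert_commute)
  have r: "degree ?F r = 2" using deg[of r] assms(3) degree_eq_0[OF FS] by simp
  have "degree ?F v = 2 \<or> degree ?F v = 4" if "v \<in> insert r S" for v
    using that r F(4) deg[of v] assms(3) by (cases "v = r") auto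
  moreover have "{r, k} \<in> ?F" by (simp add: insert_commute)
  ultimately show ?thesis
    unfolding rooted_factor_def using sub con r assms(2) by blast
qed

text \<open>Gluing a triangle on \<open>r\<close>, \<open>a\<close>, \<open>b\<close> to the piece
  at \<open>b\<close> gives the two new vertices degree 2 and raises \<open>b\<close> by 2.\<close>

lemma rooted_factor_triangle:
  assumes T: "piece T b" and "r \<noteq> a" "r \<notin> T" "a \<notin> T" "T \<subseteq> V"
    and sq: "{r, a} \<in> square V E" "{a, b} \<in> square V E" "{r, b} \<in> square V E"
    and "adj E r a"
  shows "rooted_factor (insert r (insert a T)) r"
proof -
  from T obtain H where H: "H \<subseteq> square V E \<inter> Pow T" "connected_graph T H" "b \<in> T"
    "\<forall>v\<in>T - {b}. degree H v = 2 \<or> degree H v = 4" "degree H b = 0 \<or> degree H b = 2"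
    unfolding piece_def by blast
  have HT: "H \<subseteq> Pow T" using H(1) by auto
  let ?F = "insert {r, a} (insert {a, b} (insert {r, b} H))"
  have fin: "finite H" using assms(5) finite_V HT by (meson finite_Pow_iff finite_subset)
  have ne: "{r, a} \<notin> H" "{a, b} \<notin> H" "{r, b} \<notin> H" "{r, a} \<noteq> {a, b}" "{r, a} \<noteq> {r, b}"
    "{a, b} \<noteq> {r, b}" "a \<noteq> b" "r \<noteq> b"
    using assms H(1,3) by (auto simp: doubleton_eq_iff)
  have deg: "degree ?F v = degree H v + (if v \<in> {r, a, b} then 2 else 0)" for v
    using fin ne assms(2) by (auto simp: degree_insert)
  have edges: "reach ?F r a" "reach ?F r b" by (auto intro: reach_edge)
  have "connected_graph (insert r (insert a T)) ?F"
  proof (rule connected_graphI[where r = r])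
    fix x assume "x \<in> insert r (insert a T)"
    then consider "x = r" | "x = a" | "x \<in> T" by blast
    then show "reach ?F r x"
    proof cases
      case 3
      then have "reach H b x" using H(2,3) by (simp add: connected_graph_def)
      then have "reach ?F b x" by (rule reach_mono) auto
      then show ?thesis by (rule rtrancl_trans[OF edges(2)])
    qed (use edges in auto)
  qed
  moreover have "?F \<subseteq> square V E \<inter> Pow (insert r (insert a T))"
    using sq H by auto
  moreover have "degree ?F r = 2" "degree ?F a = 2"
    using deg assms(3,4) degree_eq_0[OF HT] by auto
  moreover have "degree ?F v = 2 \<or> degree ?F v = 4" if "v \<in> T" for v
    using that deg[of v] H(4,5) assms(3,4) by auto
  ultimately show ?thesis
    unfolding rooted_factor_def using assms(9) by blast
qed

text \<open>A single edge is allowed since it becomes a triangle or longer cycle once a further piece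
  is attached.\<close>

definition attachable_to :: "'a set \<Rightarrow> 'a \<Rightarrow> bool" where
  "attachable_to T r \<longleftrightarrow> T = {r} \<or> (\<exists>a. adj E r a \<and> T = {r, a}) \<or> rooted_factor T r"

text \<open>A lone root is joined to \<open>k\<close> or inserted into the factor of
  \<open>K\<close>, a single edge closes up to a triangle through \<open>k\<close>, and a rooted
  factor is rerouted.\<close>

lemma attachable_attach:
  assumes "attachable_to T r" "piece K k" "K = {k} \<or> rooted_factor K k" "adj E r k"
    "T \<inter> K = {}" "T \<subseteq> V" "K \<subseteq> V"
  shows "attachable_to (T \<union> K) r"
proof -
  consider "T = {r}" | a where "adj E r a" "T = {r, a}" | "rooted_factor T r"
    using assms(1) by (auto simp: attachable_to_def)
  then show ?thesis
  proof cases
    case 1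
    then show ?thesis
      using assms(3-) rooted_factor_new_root[of K k r] by (auto simp: attachable_to_def)
  next
    case 2
    have "k \<in> K" using assms(2) by (auto simp: piece_def)
    then have "a \<noteq> k" using 2 assms(5) by auto
    then have "rooted_factor (insert r (insert a K)) r"
      using 2 assms adjD square_2[of r a k] by (intro rooted_factor_triangle[of K k])
        (auto intro: square_adj)
    then show ?thesis using 2 by (simp add: attachable_to_def)
  next
    case 3
    then show ?thesis using rooted_factor_attach assms by (simp add: attachable_to_def)
  qed
qed

lemma rooted_factor_triangle_path:
  assumes "adj E r v" "adj E v c" "r \<noteq> c"
  shows "rooted_factor {r, v, c} r"
proof -
  have "rooted_factor (insert r (insert v {c})) r"
    by (rule rooted_factor_triangle[OF piece_single])
      (use assms adjD square_2[of v r c] in \<open>auto intro: square_adj simp: adj_commute\<close>)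
  then show ?thesis by simp
qed

text \<open>Besides \<open>K\<close>, the neighbours of \<open>r\<close> in \<open>A\<close> are
  attached one at a time as single-vertex pieces; this is how vertices left over deeper in the
  recursion get absorbed.\<close>

lemma rooted_factor_attach_set:
  assumes "attachable_to T r" "piece K k" "K = {k} \<or> rooted_factor K k" "adj E r k"
    "finite A" "\<forall>a\<in>A. adj E r a" "T \<inter> (K \<union> A) = {}" "K \<inter> A = {}" "T \<subseteq> V" "K \<subseteq> V"
  shows "attachable_to (T \<union> (K \<union> A)) r"
  using assms(5-8)
proof (induction A rule: finite_induct)
  case empty
  then show ?case using attachable_attach[OF assms(1-4)] assms(9,10) by simp
next
  case (insert a A)
  then have "attachable_to (T \<union> (K \<union> A)) r" by blast
  then have "attachable_to (T \<union> (K \<union> A) \<union> {a}) r"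
    by (rule attachable_attach[OF _ piece_single])
      (use insert.prems insert.hyps assms(9,10) adjD in auto)
  then show ?case by simp
qed

section \<open>Induced connectedness and the components left by deleting a root\<close>

definition induced_connected :: "'a set \<Rightarrow> bool" where
  "induced_connected S \<longleftrightarrow> connected_graph S (E \<inter> Pow S)"

lemma induced_connected_Un:
  assumes "induced_connected S" "induced_connected T" "a \<in> S" "b \<in> T" "a = b \<or> adj E a b"
  shows "induced_connected (S \<union> T)"
proof -
  have "connected_graph S (E \<inter> Pow (S \<union> T))" "connected_graph T (E \<inter> Pow (S \<union> T))"
    using assms(1,2) unfolding induced_connected_def
    by (blast intro: connected_graph_mono)+
  moreover have "reach (E \<inter> Pow (S \<union> T)) a b"
    using assms(3-) by (auto simp: adj_def intro: reach_edge)
  ultimately show ?thesis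
    unfolding induced_connected_def using assms(3,4) by (blast intro: connected_graph_Un)
qed

lemma induced_connected_single: "induced_connected {a}"
  by (simp add: induced_connected_def connected_graph_def)

lemma induced_connected_neighbour:
  assumes "induced_connected S" "x \<in> S" "y \<in> S" "x \<noteq> y"
  obtains z where "z \<in> S" "adj E x z"
proof -
  have "reach (E \<inter> Pow S) x y"
    using assms by (simp add: induced_connected_def connected_graph_def)
  then show thesis
    using assms(4) that by (cases rule: converse_rtranclE) (auto simp: adj_def)
qed

text \<open>A component of the graph induced on \<open>S - {r}\<close>, expressed by closure.
  Connectedness of both \<open>K\<close> and \<open>S - K\<close> is recorded because the induction
  recurses on each.\<close>

definition branch :: "'a set \<Rightarrow> 'a \<Rightarrow> 'a set \<Rightarrow> bool" where
  "branch S r K \<longleftrightarrow> K \<subseteq> S - {r} \<and> induced_connected K \<and> induced_connected (S - K) \<and>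
     (\<forall>u\<in>K. \<forall>w\<in>S - K. adj E u w \<longrightarrow> w = r) \<and> (\<exists>k\<in>K. adj E r k)"

lemma branch_exists:
  assumes S: "induced_connected S" "r \<in> S" and x: "x \<in> S" "x \<noteq> r"
  obtains K where "x \<in> K" "branch S r K"
proof -
  let ?R = "E \<inter> Pow (S - {r})"
  define K where "K = {y. reach ?R x y}"
  have xK: "x \<in> K" by (simp add: K_def)
  have sub: "y \<in> S - {r}" if "y \<in> K" for y
  proof -
    have "reach ?R x y" using that by (simp add: K_def)
    then show ?thesis using x by (cases rule: rtranclE) (auto simp: adj_def)
  qed
  have closed: "w = r" if "u \<in> K" "w \<in> S - K" "adj E u w" for u w
  proof (rule ccontr)
    assume "w \<noteq> r"
    then have "adj ?R u w" using that sub[OF that(1)] by (auto simp: adj_def)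
    then have "w \<in> K" using that(1) rtrancl_into_rtrancl[of x u] by (auto simp: K_def)
    then show False using that by blast
  qed
  have conK: "induced_connected K"
    unfolding induced_connected_def
  proof (rule connected_graphI[where r = x])
    fix y assume "y \<in> K"
    then have "reach ?R x y" by (simp add: K_def)
    then show "reach (E \<inter> Pow K) x y"
    proof (induction rule: rtrancl_induct)
      case (step y z)
      then have "y \<in> K" by (simp add: K_def)
      moreover have "z \<in> K"
        unfolding K_def using rtrancl_into_rtrancl[OF step(1,2)] by simp
      ultimately have "adj (E \<inter> Pow K) y z" using step(2) by (auto simp: adj_def)
      then show ?case using rtrancl_into_rtrancl[OF step.IH] by simp
    qed simp
  qed
  have root: "reach (E \<inter> Pow S) y r" if "y \<in> S" for y
    using S that by (simp add: induced_connected_def connected_graph_def)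
  \<comment> \<open>One backward induction along a path to \<open>r\<close> gives both claims: a
    path can leave \<open>K\<close> only at \<open>r\<close>, and from a vertex outside
    \<open>K\<close> other than \<open>r\<close> it cannot step into \<open>K\<close>.\<close>
  have "(y \<in> K \<longrightarrow> (\<exists>k\<in>K. adj E r k)) \<and> (y \<notin> K \<longrightarrow> reach (E \<inter> Pow (S - K)) y r)"
    if "y \<in> S" for y
    using root[OF that]
  proof (induction rule: converse_rtrancl_induct)
    case base
    then show ?case using sub by blast
  next
    case (step y z)
    then have yz: "adj E y z" "y \<in> S" "z \<in> S" by (auto simp: adj_def)
    consider "y \<in> K" | "y = r" | "y \<notin> K" "y \<noteq> r" by blast
    then show ?case
    proof cases
      case 1
      show ?thesis
      proof (cases "z \<in> K")
        case False
        then have "z = r" using closed[OF 1] yz by blast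
        then show ?thesis using 1 yz adj_commute by fast
      qed (use step.IH 1 in blast)
    next
      case 2
      then show ?thesis using sub by blast
    next
      case 3
      have "z \<notin> K" using closed[of z y] 3 yz adj_commute by fast
      then have "adj (E \<inter> Pow (S - K)) y z" using 3 yz by (auto simp: adj_def)
      moreover have "reach (E \<inter> Pow (S - K)) z r" using step.IH \<open>z \<notin> K\<close> by blast
      ultimately show ?thesis using 3 by (auto intro: converse_rtrancl_into_rtrancl)
    qed
  qed
  note claim = this
  have "induced_connected (S - K)"
    unfolding induced_connected_def
  proof (rule connected_graphI[where r = r])
    fix y assume "y \<in> S - K"
    then show "reach (E \<inter> Pow (S - K)) r y" using claim[of y] by (auto intro: reach_sym)
  qed
  moreover have "\<exists>k\<in>K. adj E r k" using claim[of x] x xK by blast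
  ultimately have "branch S r K" unfolding branch_def using sub closed conK by blast
  then show thesis using that xK by blast
qed

section \<open>Leaves, bad leaves and distance 4\<close>

lemma is_leafI:
  assumes "adj E c v" "\<And>w. adj E c w \<Longrightarrow> w = v"
  shows "is_leaf V E c"
proof -
  have "e = {c, v}" if e: "e \<in> E" "c \<in> e" for e
  proof -
    obtain a b where "e = {a, b}" using simple e(1) unfolding simple_graph_def by metis
    then obtain w where "e = {c, w}" using e(2) by (metis insert_commute insertE singletonD)
    then show ?thesis using assms(2)[of w] e(1) by (simp add: adj_def)
  qed
  moreover have "{c, v} \<in> E" using assms(1) by (simp add: adj_def)
  ultimately have "{e \<in> E. c \<in> e} = {{c, v}}" by blast
  then show ?thesis using adjD[OF assms(1)] by (simp add: is_leaf_def degree_def)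
qed

lemma is_leafD:
  assumes "is_leaf V E c" "adj E c v" "adj E c w"
  shows "v = w"
proof -
  have "card {e \<in> E. c \<in> e} = 1" using assms(1) by (simp add: is_leaf_def degree_def)
  then obtain e where "{e \<in> E. c \<in> e} = {e}" by (auto simp: card_1_singleton_iff)
  moreover have "{c, v} \<in> {e \<in> E. c \<in> e}" "{c, w} \<in> {e \<in> E. c \<in> e}"
    using assms by (auto simp: adj_def)
  ultimately have "{c, v} = {c, w}" by simp
  then show ?thesis by (auto simp: doubleton_eq_iff)
qed

lemma del_edges_induced: "del_edges (E \<inter> Pow W) S = E \<inter> Pow (W - S)"
  by (auto simp: del_edges_def)

text \<open>Deleting \<open>v\<close> isolates \<open>c\<close> from \<open>r\<close>, so
  \<open>v\<close> is a cut vertex; once \<open>c\<close> is gone, deleting \<open>v\<close> leaves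
  a connected graph, so it is trivial. The assumption \<open>other\<close> excludes a second leaf at
  \<open>v\<close>.\<close>

lemma bad_leafI:
  assumes c: "adj E c v" "\<And>w. adj E c w \<Longrightarrow> w = v"
    and con: "induced_connected (V - {v, c})" and r: "r \<in> V" "r \<notin> {v, c}"
    and other: "\<And>w. w \<noteq> c \<Longrightarrow> adj E w v \<Longrightarrow> \<exists>u. u \<noteq> v \<and> adj E w u"
  shows "bad_leaf V E c"
proof -
  have EV: "E \<inter> Pow V = E" using simple by (auto simp: simple_graph_def)
  have vc: "v \<in> V" "c \<in> V" "v \<noteq> c" using adjD[OF c(1)] by auto
  have leaf: "is_leaf V E c" using c by (rule is_leafI)
  have leaves: "leaves_at V E v = {c}"
    using leaf c(1) other is_leafD by (fastforce simp: leaves_at_def)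
  have del: "del_edges E {v} = E \<inter> Pow (V - {v})"
    "del_edges (del_edges E {c}) {v} = E \<inter> Pow (V - {c} - {v})"
    using del_edges_induced EV by metis+
  have "\<not> connected_graph (V - {v}) (E \<inter> Pow (V - {v}))"
  proof
    assume "connected_graph (V - {v}) (E \<inter> Pow (V - {v}))"
    then have "induced_connected (V - {v})" by (simp add: induced_connected_def)
    then obtain z where "z \<in> V - {v}" "adj E c z"
      by (rule induced_connected_neighbour[of _ c r]) (use vc r in auto)
    then show False using c(2) by blast
  qed
  moreover have "V - {c} - {v} = V - {v, c}" by blast
  ultimately have "trivial_cut_vertex V E v"
    using con vc leaves del
    by (simp add: trivial_cut_vertex_def cut_vertex_def induced_connected_def)
  then show ?thesis using leaf leaves c(1) by (auto simp: bad_leaf_def)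
qed

text \<open>The path through \<open>r\<close> has length 4. Every walk from \<open>c\<close> to
  \<open>d\<close> has \<open>v\<close> second and \<open>v'\<close> second to last, which rules out
  lengths 1, 2 and 3.\<close>

lemma gdist_4:
  assumes c: "adj E c v" "\<And>w. adj E c w \<Longrightarrow> w = v" and d: "adj E d v'" "\<And>w. adj E d w \<Longrightarrow> w = v'"
    and r: "adj E v r" "adj E r v'" and ne: "v \<noteq> v'" "\<not> adj E v v'" "c \<noteq> d" "c \<noteq> v'"
  shows "gdist E c d = 4"
  unfolding gdist_def
proof (rule Least_equality)
  have "walk E [c, v, r, v', d]"
    using c(1) d(1) r by (auto simp: walk_def nth_Cons adj_commute split: nat.splits)
  then show "\<exists>xs. walk E xs \<and> hd xs = c \<and> last xs = d \<and> length xs = Suc 4"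
    by (intro exI[of _ "[c, v, r, v', d]"]) simp
next
  fix n assume "\<exists>xs. walk E xs \<and> hd xs = c \<and> last xs = d \<and> length xs = Suc n"
  then obtain xs where xs: "walk E xs" "hd xs = c" "last xs = d" "length xs = Suc n" by blast
  have ends: "xs ! 0 = c" "xs ! n = d"
    using xs by (auto simp: hd_conv_nth last_conv_nth walk_def)
  have step: "adj E (xs ! i) (xs ! Suc i)" if "i < n" for i
    using xs(1,4) that by (simp add: walk_def)
  have "n \<noteq> 0" using ends ne(3) by metis
  then have first: "xs ! Suc 0 = v" using step[of 0] ends c(2) by simp
  have last: "xs ! (n - 1) = v'"
    using step[of "n - 1"] \<open>n \<noteq> 0\<close> ends d(2) adj_commute by fastforce
  show "4 \<le> n"
  proof (rule ccontr)
    assume "\<not> 4 \<le> n"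
    then consider "n = 1" | "n = 2" | "n = 3" using \<open>n \<noteq> 0\<close> by linarith
    then show False
    proof cases
      case 1
      then show ?thesis using last ends ne(4) by simp
    next
      case 2
      then show ?thesis using last first ne(1) by simp
    next
      case 3
      then show ?thesis using last first step[of 1] ne(2) by (simp add: numeral_2_eq_2)
    qed
  qed
qed

section \<open>Pendant branches and the choice of a branch\<close>

text \<open>The last conjunct ranges over all of \<open>E\<close>, so \<open>c\<close> is a leaf of
  the whole graph and not merely of an induced part.\<close>

definition pendant :: "'a set \<Rightarrow> 'a \<Rightarrow> bool" where
  "pendant K r \<longleftrightarrow>
     (\<exists>v c. K = {v, c} \<and> adj E r v \<and> adj E c v \<and> (\<forall>w. adj E c w \<longrightarrow> w = v))"

text \<open>No other neighbour of \<open>v\<close> is a leaf: \<open>r\<close> also sees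
  \<open>s\<close>, and any further one has a neighbour in the connected set
  \<open>V - {v, c}\<close>, which contains \<open>r\<close>.\<close>

lemma pendant_bad_leaf:
  assumes c: "adj E c v" "\<And>w. adj E c w \<Longrightarrow> w = v"
    and con: "induced_connected (V - {v, c})"
    and r: "adj E r v" "r \<noteq> c" "adj E r s" "s \<noteq> v"
  shows "bad_leaf V E c"
proof (rule bad_leafI[OF c con])
  show "r \<in> V" "r \<notin> {v, c}" using r adjD by auto
  fix w assume w: "w \<noteq> c" "adj E w v"
  show "\<exists>u. u \<noteq> v \<and> adj E w u"
  proof (cases "w = r")
    case False
    have "w \<in> V - {v, c}" "r \<in> V - {v, c}" using w r adjD by auto
    then obtain z where "z \<in> V - {v, c}" "adj E w z"
      using induced_connected_neighbour[OF con _ _ False] by blast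
    then show ?thesis by blast
  qed (use r in blast)
qed

text \<open>If a pendant branch is not all of \<open>S - {r}\<close>, another branch is taken
  instead. Were both pendant, each would supply the second neighbour of \<open>r\<close> that makes
  the other's leaf bad, and the leaves would be at distance 4.\<close>

lemma nonpendant_branch:
  assumes dist: "\<And>x y. bad_leaf V E x \<Longrightarrow> bad_leaf V E y \<Longrightarrow> gdist E x y \<noteq> 4"
    and S: "induced_connected S" "S \<subseteq> V" "r \<in> S" "S \<noteq> {r}"
    and out: "induced_connected (insert r (V - S))"
  obtains K where "branch S r K" "K = S - {r} \<or> \<not> pendant K r"
proof -
  have rest: "induced_connected (V - K)" if "branch S r K" for K
  proof -
    have "induced_connected (insert r (V - S) \<union> (S - K))"
      by (rule induced_connected_Un[OF out, of _ r r])
        (use that S(3) in \<open>auto simp: branch_def\<close>)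
    moreover have "insert r (V - S) \<union> (S - K) = V - K"
      using that S(2,3) by (auto simp: branch_def)
    ultimately show ?thesis by simp
  qed
  obtain x where "x \<in> S" "x \<noteq> r" using S(3,4) by blast
  then obtain K where K: "branch S r K" using branch_exists[OF S(1,3)] by blast
  show thesis
  proof (cases "K = S - {r} \<or> \<not> pendant K r")
    case False
    then obtain v c where vc: "K = {v, c}" "adj E r v" "adj E c v" "\<And>w. adj E c w \<Longrightarrow> w = v"
      unfolding pendant_def by blast
    obtain y where y: "y \<in> S" "y \<noteq> r" "y \<notin> K" using False K by (auto simp: branch_def)
    then obtain K' where K': "y \<in> K'" "branch S r K'" using branch_exists[OF S(1,3)] by blast
    have "\<not> pendant K' r"
    proof
      assume "pendant K' r"
      then obtain v' d where vd: "K' = {v', d}" "adj E r v'" "adj E d v'"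
        "\<And>w. adj E d w \<Longrightarrow> w = v'"
        unfolding pendant_def by blast
      have cl: "w = r" if "u \<in> K" "w \<in> S - K" "adj E u w" for u w
        using K that by (auto simp: branch_def)
      have KS: "K \<subseteq> S - {r}" "K' \<subseteq> S - {r}" using K K' by (auto simp: branch_def)
      have "adj E v' d" using vd(3) adj_commute by fast
      \<comment> \<open>The vertex \<open>y\<close> is \<open>v'\<close> or \<open>d\<close> and
        lies outside \<open>K\<close>; were the other one in \<open>K\<close>, the edge between them
        would force \<open>y = r\<close>.\<close>
      then have disj: "v' \<notin> K" "d \<notin> K"
        using cl[of v' y] cl[of d y] y K'(1) vd(1,3) by auto
      then have ne: "v \<noteq> v'" "c \<noteq> d" "c \<noteq> v'" "\<not> adj E v v'"
        using cl[of v v'] vc(1) vd(1) KS by auto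
      have "bad_leaf V E c"
        by (rule pendant_bad_leaf[OF vc(3,4) _ vc(2) _ vd(2)])
          (use rest[OF K] vc(1) KS ne in auto)
      moreover have "bad_leaf V E d"
        by (rule pendant_bad_leaf[OF vd(3,4) _ vd(2) _ vc(2)])
          (use rest[OF K'(2)] vd(1) KS ne in auto)
      moreover have "adj E v r" using vc(2) adj_commute by fast
      then have "gdist E c d = 4"
        using gdist_4[OF vc(3,4) vd(3,4)] vd(2) ne by blast
      ultimately show False using dist by blast
    qed
    then show thesis using that K'(2) by blast
  qed (use that K in blast)
qed

section \<open>Attaching a non-pendant branch\<close>

lemma rooted_factor_other:
  assumes "rooted_factor S r"
  obtains k where "k \<in> S" "k \<noteq> r"
proof -
  obtain F k where "F \<subseteq> square V E \<inter> Pow S" "{r, k} \<in> F" "adj E r k"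
    using assms unfolding rooted_factor_def by blast
  moreover from this have "k \<in> S" "k \<noteq> r" using adjD[of r k] by auto
  ultimately show thesis using that by blast
qed

text \<open>Here \<open>X\<close> collects the vertices of \<open>K\<close> passed on to earlier
  roots. Quantifying over \<open>T\<close> lets the branch be glued to the bare root or to what was
  built on the rest of \<open>S\<close>. The last conclusion keeps a large branch from shrinking to
  \<open>k\<close> alone.\<close>

lemma branch_attach:
  assumes K: "induced_connected K" "K \<subseteq> V" "r \<notin> K" "k \<in> K" "adj E r k" "\<not> pendant K r"
    and large: "3 \<le> card K \<Longrightarrow>
      \<exists>X \<subseteq> K - {k}. (\<forall>x\<in>X. \<exists>u\<in>V - K. adj E x u) \<and> rooted_factor (K - X) k"
  obtains X where "X \<subseteq> K - {k}" "\<And>x. x \<in> X \<Longrightarrow> \<exists>u\<in>V - insert r K. adj E x u"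
    "\<And>T. attachable_to T r \<Longrightarrow> T \<inter> K = {} \<Longrightarrow> T \<subseteq> V \<Longrightarrow> attachable_to (T \<union> (K - X)) r"
    "3 \<le> card K \<Longrightarrow> K - X \<noteq> {k}"
proof -
  have finK: "finite K" using K(2) finite_V finite_subset by blast
  have "card K \<noteq> 0" using K(4) finK by auto
  then consider "card K = 1" | "card K = 2" | "3 \<le> card K" by linarith
  then show thesis
  proof cases
    case 1
    then have "K = {k}" using K(4) by (auto simp: card_1_singleton_iff)
    then show ?thesis
      using that[of "{}"] attachable_attach[OF _ piece_single] K(2,5) by auto
  next
    case 2
    then obtain c where c: "K = {k, c}" "c \<noteq> k"
      using K(4) by (auto simp: card_2_iff)
    obtain z where "z \<in> K" "adj E c z"
      using induced_connected_neighbour[OF K(1), of c k] c by auto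
    then have ck: "adj E c k" using c adjD[of c z] by auto
    show ?thesis
    proof (cases "adj E r c")
      case True
      have "attachable_to (T \<union> ({k} \<union> {c})) r"
        if "attachable_to T r" "T \<inter> K = {}" "T \<subseteq> V" for T
        by (rule rooted_factor_attach_set[OF that(1) piece_single])
          (use K(2,5) True c that in auto)
      then show ?thesis using that[of "{}"] c(1) 2 by (simp add: insert_commute)
    next
      case False
      \<comment> \<open>As \<open>K\<close> is not pendant, \<open>c\<close> has a neighbour besides
        \<open>k\<close>; it lies outside \<open>K\<close> and differs from \<open>r\<close>, so
        \<open>c\<close> may be left over.\<close>
      then obtain w where w: "adj E c w" "w \<noteq> k"
        using K(5,6) ck c(1) unfolding pendant_def by blast
      then have "w \<in> V - insert r K" using False c(1) adjD adj_commute by fastforce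
      moreover have "K - {c} = {k}" using c by auto
      moreover have "attachable_to (T \<union> {k}) r"
        if "attachable_to T r" "T \<inter> K = {}" "T \<subseteq> V" for T
        using attachable_attach[OF that(1) piece_single _ K(5)] that K(2,4) by auto
      ultimately show ?thesis using that[of "{c}"] w(1) c 2 by auto
    qed
  next
    case 3
    then obtain X0 where X0: "X0 \<subseteq> K - {k}" "\<And>x. x \<in> X0 \<Longrightarrow> \<exists>u\<in>V - K. adj E x u"
      "rooted_factor (K - X0) k" using large by blast
    \<comment> \<open>Leftovers adjacent to \<open>r\<close> have reached an earlier root and are
      inserted now; the others stay left over.\<close>
    define A where "A = {x \<in> X0. adj E r x}"
    have KA: "K - (X0 - A) = (K - X0) \<union> A" using X0(1) by (auto simp: A_def)
    show ?thesis
    proof (rule that[of "X0 - A"])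
      fix x assume x: "x \<in> X0 - A"
      then obtain u where "u \<in> V - K" "adj E x u" using X0(2) by blast
      then show "\<exists>u\<in>V - insert r K. adj E x u"
        using x adj_commute[of E x r] by (auto simp: A_def)
    next
      fix T assume T: "attachable_to T r" "T \<inter> K = {}" "T \<subseteq> V"
      have "attachable_to (T \<union> ((K - X0) \<union> A)) r"
        by (rule rooted_factor_attach_set[OF T(1) rooted_factor_piece[OF X0(3)] _ K(5)])
          (use X0 finK K(2) T in \<open>auto simp: A_def intro: finite_subset\<close>)
      then show "attachable_to (T \<union> (K - (X0 - A))) r" by (simp only: KA)
    next
      obtain z where "z \<in> K - X0" "z \<noteq> k" using rooted_factor_other[OF X0(3)] by blast
      then show "K - (X0 - A) \<noteq> {k}" by blast
    qed (use X0 in blast)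
  qed
qed

section \<open>The induction on the size of the vertex set\<close>

lemma attachable_large:
  assumes "attachable_to T r" "x \<in> T" "y \<in> T" "x \<noteq> r" "y \<noteq> r" "x \<noteq> y"
  shows "rooted_factor T r"
  using assms by (auto simp: attachable_to_def)

text \<open>\<open>X\<close> is the set of vertices left over for an earlier root. Connectivity of \<open>insert r (V - S)\<close>
  makes the leaf of a pendant component a bad leaf.\<close>

lemma rooted_factor_exists:
  assumes dist: "\<And>x y. bad_leaf V E x \<Longrightarrow> bad_leaf V E y \<Longrightarrow> gdist E x y \<noteq> 4"
  shows "induced_connected S \<Longrightarrow> S \<subseteq> V \<Longrightarrow> r \<in> S \<Longrightarrow> induced_connected (insert r (V - S)) \<Longrightarrow>
    3 \<le> card S \<Longrightarrow> \<exists>X \<subseteq> S - {r}. (\<forall>x\<in>X. \<exists>u\<in>V - S. adj E x u) \<and> rooted_factor (S - X) r"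
proof (induction "card S" arbitrary: S r rule: less_induct)
  case less
  note S = less.prems
  have finS: "finite S" using S(2) finite_V finite_subset by blast
  have "S \<noteq> {r}" using S(5) by auto
  then obtain K where br: "branch S r K" and pend: "K = S - {r} \<or> \<not> pendant K r"
    using nonpendant_branch[OF dist S(1-3) _ S(4)] by blast
  then obtain k where k: "k \<in> K" "adj E r k" by (auto simp: branch_def)
  have K: "K \<subseteq> S - {r}" "induced_connected K" "induced_connected (S - K)"
    and closed: "\<And>u w. u \<in> K \<Longrightarrow> w \<in> S - K \<Longrightarrow> adj E u w \<Longrightarrow> w = r"
    using br by (auto simp: branch_def)
  have finK: "finite K" using K(1) finS finite_subset by blast
  show ?case
  proof (cases "pendant K r")
    case True
    then obtain v c where vc: "K = {v, c}" "adj E r v" "adj E c v"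
      unfolding pendant_def by blast
    \<comment> \<open>A pendant \<open>K\<close> is chosen only when it is the sole branch, so
      \<open>S\<close> is the path \<open>r\<close>, \<open>v\<close>, \<open>c\<close>.\<close>
    moreover have "S = insert r K" using True pend S(3) by auto
    ultimately have "rooted_factor S r"
      using rooted_factor_triangle_path[of r v c] K(1) adj_commute[of E c v] by auto
    then show ?thesis by (intro exI[of _ "{}"]) simp
  next
    case False
    have KV: "K \<subseteq> V" "r \<notin> K" using K(1) S(2) by auto
    have large: "\<exists>X \<subseteq> K - {k}. (\<forall>x\<in>X. \<exists>u\<in>V - K. adj E x u) \<and> rooted_factor (K - X) k"
      if "3 \<le> card K"
    proof (rule less.hyps)
      show "card K < card S" using K(1) S(3) finS by (auto intro: psubset_card_mono)
      have "induced_connected (insert r (V - S) \<union> (S - K))"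
        by (rule induced_connected_Un[OF S(4) K(3), of r r]) (use K(1) S(3) in auto)
      then have "induced_connected (insert r (V - S) \<union> (S - K) \<union> {k})"
        by (rule induced_connected_Un[OF _ induced_connected_single, of _ r]) (use k in auto)
      moreover have "insert r (V - S) \<union> (S - K) \<union> {k} = insert k (V - K)"
        using K(1) S(2,3) by auto
      ultimately show "induced_connected (insert k (V - K))" by simp
    qed (use K S k that in auto)
    obtain X where X: "X \<subseteq> K - {k}" "\<And>x. x \<in> X \<Longrightarrow> \<exists>u\<in>V - insert r K. adj E x u"
      "\<And>T. attachable_to T r \<Longrightarrow> T \<inter> K = {} \<Longrightarrow> T \<subseteq> V \<Longrightarrow> attachable_to (T \<union> (K - X)) r"
      "3 \<le> card K \<Longrightarrow> K - X \<noteq> {k}"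
      by (rule branch_attach[OF K(2) KV k False large]) (assumption, rule that)
    \<comment> \<open>The neighbour found outside \<open>insert r K\<close> cannot lie in
      \<open>S\<close>, since \<open>r\<close> is the only vertex of \<open>S - K\<close> adjacent
      to \<open>K\<close>.\<close>
    have outX: "\<exists>u\<in>V - S. adj E x u" if "x \<in> X" for x
    proof -
      obtain u where u: "u \<in> V - insert r K" "adj E x u" using X(2) \<open>x \<in> X\<close> by blast
      then show ?thesis using closed[of x u] that X(1) by blast
    qed
    show ?thesis
    proof (cases "K = S - {r}")
      case True
      then have SK: "S = insert r K" using S(3) by blast
      then have cK: "card S = Suc (card K)" using KV(2) finK by simp
      show ?thesis
      \<comment> \<open>With two vertices in \<open>K\<close> the triangle is built directly:
        \<open>X\<close> might contain \<open>c\<close>, and the single edge \<open>rk\<close> would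
        be no factor.\<close>
      proof (cases "card K = 2")
        case True
        then obtain c where c: "K = {k, c}" "c \<noteq> k" using k(1) by (auto simp: card_2_iff)
        obtain z where z: "z \<in> K" "adj E k z"
          using induced_connected_neighbour[OF K(2), of k c] c by auto
        then have "adj E k c" using c adjD[of k z] by auto
        then have "rooted_factor S r"
          using rooted_factor_triangle_path[OF k(2), of c] SK c KV(2) by auto
        then show ?thesis by (intro exI[of _ "{}"]) simp
      next
        case False
        then have "3 \<le> card K" using cK S(5) by linarith
        then obtain z where "z \<in> K - X" "z \<noteq> k" using X(1,4) k(1) by blast
        moreover have "attachable_to ({r} \<union> (K - X)) r"
          using X(3)[of "{r}"] K(1) S(2,3) by (auto simp: attachable_to_def)
        moreover have "{r} \<union> (K - X) = S - X" using SK X(1) K(1) by auto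
        ultimately have "rooted_factor (S - X) r"
          using attachable_large[of "S - X" r z k] K(1) k(1) X(1) by auto
        then show ?thesis using outX X(1) K(1) by blast
      qed
    next
      case False
      obtain a where a: "a \<in> S - K" "a \<noteq> r" using False K(1) by blast
      have r: "r \<in> S - K" using S(3) K(1) by blast
      \<comment> \<open>The rest \<open>S - K\<close> is treated first with the same root, by
        recursion or as a single edge, and \<open>K\<close> is then glued on; \<open>Y\<close>
        collects its leftovers.\<close>
      have "\<exists>Y \<subseteq> S - K - {r}. (\<forall>x\<in>Y. \<exists>u\<in>V - S. adj E x u) \<and>
          attachable_to (S - K - Y) r \<and> S - K - Y \<noteq> {r}"
      proof (cases "3 \<le> card (S - K)")
        case True
        have "\<exists>Y \<subseteq> S - K - {r}. (\<forall>x\<in>Y. \<exists>u\<in>V - (S - K). adj E x u) \<and>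
          rooted_factor (S - K - Y) r"
        proof (rule less.hyps)
          show "card (S - K) < card S"
            using K(1) k(1) finS by (intro psubset_card_mono) auto
          have "induced_connected (insert r (V - S) \<union> K)"
            by (rule induced_connected_Un[OF S(4) K(2) _ k(1), of r]) (use k in auto)
          moreover have "insert r (V - S) \<union> K = insert r (V - (S - K))"
            using K(1) S(2) by auto
          ultimately show "induced_connected (insert r (V - (S - K)))" by simp
        qed (use K S r True in auto)
        then obtain Y where Y: "Y \<subseteq> S - K - {r}" "\<And>x. x \<in> Y \<Longrightarrow> \<exists>u\<in>V - (S - K). adj E x u"
          "rooted_factor (S - K - Y) r" by blast
        have "\<exists>u\<in>V - S. adj E x u" if "x \<in> Y" for x
        proof -
          obtain u where u: "u \<in> V - (S - K)" "adj E x u" using Y(2) \<open>x \<in> Y\<close> by blast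
          then have "u \<notin> K" using closed[of u x] Y(1) \<open>x \<in> Y\<close> adj_commute[of E u x] by blast
          then show ?thesis using u by blast
        qed
        moreover obtain z where "z \<in> S - K - Y" "z \<noteq> r"
          by (rule rooted_factor_other[OF Y(3)])
        then have "S - K - Y \<noteq> {r}" by blast
        moreover have "attachable_to (S - K - Y) r" using Y(3) by (simp add: attachable_to_def)
        ultimately show ?thesis using Y(1) by blast
      next
        case False
        have "card {r, a} = 2" using a by simp
        moreover have "{r, a} \<subseteq> S - K" using a r by blast
        moreover have "card (S - K) \<le> 2" using False by simp
        ultimately have SK: "S - K = {r, a}"
          using finS by (metis card_seteq finite_Diff)
        obtain z where "z \<in> S - K" "adj E r z"
          using induced_connected_neighbour[OF K(3) r a(1)] a(2) by metis
        then have "adj E r a" using SK adjD[of r z] by auto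
        then have "attachable_to (S - K - {}) r" using SK by (auto simp: attachable_to_def)
        then show ?thesis using SK a by (intro exI[of _ "{}"]) auto
      qed
      then obtain Y where Y: "Y \<subseteq> S - K - {r}" "\<And>x. x \<in> Y \<Longrightarrow> \<exists>u\<in>V - S. adj E x u"
        "attachable_to (S - K - Y) r" "S - K - Y \<noteq> {r}" by blast
      have "attachable_to ((S - K - Y) \<union> (K - X)) r"
        by (rule X(3)[OF Y(3)]) (use S(2) in auto)
      moreover have "(S - K - Y) \<union> (K - X) = S - (Y \<union> X)" using Y(1) X(1) K(1) by blast
      \<comment> \<open>Together with \<open>k\<close>, this vertex excludes the two degenerate
        forms of \<open>attachable_to\<close>.\<close>
      moreover obtain z where "z \<in> S - K - Y" "z \<noteq> r" using Y(1,4) r by blast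
      ultimately have "rooted_factor (S - (Y \<union> X)) r"
        using attachable_large[of "S - (Y \<union> X)" r z k] k(1) K(1) X(1) Y(1) by auto
      moreover have "Y \<union> X \<subseteq> S - {r}" using X(1) Y(1) K(1) by blast
      ultimately show ?thesis using outX Y(2) by blast
    qed
  qed
qed

end

theorem theorem5:
  fixes V :: "'a set" and E :: "'a set set"
  assumes "simple_graph V E"
    and "connected_graph V E"
    and "card V \<ge> 3"
    and "\<not> (\<exists>e. nontrivial_bridge V E e)"
    and "\<not> (\<exists>x y. bad_leaf V E x \<and> bad_leaf V E y \<and> gdist E x y = 4)"
  shows "\<exists>F. factor_24 V (square V E) F"
proof -
  interpret sgraph V E using assms(1) by unfold_locales
  obtain r where r: "r \<in> V" using assms(3) by fastforce
  have "E \<inter> Pow V = E" using assms(1) by (auto simp: simple_graph_def)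
  then have "induced_connected V" using assms(2) by (simp add: induced_connected_def)
  then have "\<exists>X \<subseteq> V - {r}. (\<forall>x\<in>X. \<exists>u\<in>V - V. adj E x u) \<and> rooted_factor (V - X) r"
    by (rule rooted_factor_exists[rotated])
      (use assms(3,5) r induced_connected_single in auto)
  \<comment> \<open>For \<open>S = V\<close> a leftover would need a neighbour in
    \<open>V - V\<close>, so none exists.\<close>
  then obtain X where "rooted_factor (V - X) r" "X = {}" by blast
  then have "rooted_factor V r" by simp
  then show ?thesis unfolding rooted_factor_def factor_24_def by blast
qed

end
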